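(* Let $k,m,n$ be integers with $3\leq k\leq mn$, and let $G,H$ be connected graphs with $V(G)=\{g_1,\ldots,g_n\}$ and $V(H)=\{h_1,\ldots,h_m\}$. Let $S=\{(g_{i_1},h_{j_1}),(g_{i_2},h_{j_2}),\ldots,(g_{i_k},h_{j_k})\}$ be a set of $k$ distinct vertices of $G\Box H$, and let $S_G=\{g_{i_1},\ldots,g_{i_k}\}$ and $S_H=\{h_{j_1},\ldots,h_{j_k}\}$, regarded as multisets. Let $r$ be the minimum, over all $(k-3)$-element sub-multisets $X$ of $S_G$ (i.e. obtained from $S_G$ by deleting three of its $k$ entries; there are $\binom{k}{3}$ of them), of the number of distinct vertices in $X$; and let $t$ be the minimum, over all $(k-3)$-element sub-multisets $Y$ of $S_H$, of the number of distinct vertices in $Y$ (so $0\le r,t\le k-3$). Then $$d_G(S_G)+d_H(S_H)\leq d_{G\Box H}(S)\leq \min\{d_G(S_G)+(r+1)d_H(S_H),\ d_H(S_H)+(t+1)d_G(S_G)\}.$$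
   Context: All graphs are finite, simple and undirected. For a graph $F$ and a set (or multiset) $S$ of vertices of $F$, the Steiner distance $d_F(S)$ is the minimum number of edges of a connected subgraph of $F$ whose vertex set contains every vertex of $S$ ($d_F(S)=\infty$ if no such subgraph exists); for a multiset this depends only on its underlying set. The Cartesian product $G\Box H$ has vertex set $V(G)\times V(H)$, with $(g,h)$ adjacent to $(g',h')$ iff either $g=g'$ and $hh'\in E(H)$, or $h=h'$ and $gg'\in E(G)$. *)

theory Defs
  imports "HOL-Library.Multiset" "HOL-Library.Extended_Nat"
begin

record 'a ugraph =
  verts :: "'a set"
  edges :: "'a set set"

definition sgraph :: "'a ugraph \<Rightarrow> bool" where
  "sgraph F \<longleftrightarrow> finite (verts F) \<and> (\<forall>e\<in>edges F. e \<subseteq> verts F \<and> card e = 2)"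

definition adj :: "'a ugraph \<Rightarrow> 'a \<Rightarrow> 'a \<Rightarrow> bool" where
  "adj F u v \<longleftrightarrow> {u, v} \<in> edges F"

definition connected_graph :: "'a ugraph \<Rightarrow> bool" where
  "connected_graph F \<longleftrightarrow> verts F \<noteq> {} \<and> (\<forall>u\<in>verts F. \<forall>v\<in>verts F. (adj F)\<^sup>*\<^sup>* u v)"

definition subgraph :: "'a ugraph \<Rightarrow> 'a ugraph \<Rightarrow> bool" where
  "subgraph T F \<longleftrightarrow> sgraph T \<and> verts T \<subseteq> verts F \<and> edges T \<subseteq> edges F"

text \<open>The infimum of the empty set in \<^typ>\<open>enat\<close> is \<open>\<infinity>\<close>, and that of a nonempty set is attained.\<close>

definition steiner_dist :: "'a ugraph \<Rightarrow> 'a set \<Rightarrow> enat" where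
  "steiner_dist F S =
     Inf {enat (card (edges T)) | T. subgraph T F \<and> connected_graph T \<and> S \<subseteq> verts T}"

definition cart_prod :: "'a ugraph \<Rightarrow> 'b ugraph \<Rightarrow> ('a \<times> 'b) ugraph" where
  "cart_prod G H =
     \<lparr>verts = verts G \<times> verts H,
      edges = {{(g, h), (g', h')} | g h g' h'.
                 g \<in> verts G \<and> g' \<in> verts G \<and> h \<in> verts H \<and> h' \<in> verts H \<and>
                 (g = g' \<and> adj H h h' \<or> h = h' \<and> adj G g g')}\<rparr>"

definition min_distinct :: "nat \<Rightarrow> 'a multiset \<Rightarrow> nat" where
  "min_distinct q M = Min {card (set_mset X) | X. X \<subseteq># M \<and> size X = q}"

lemma sgraph_cart_prod:
  assumes "sgraph G" "sgraph H"
  shows "sgraph (cart_prod G H)"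
  using assms
  by (fastforce simp: sgraph_def cart_prod_def adj_def card_2_iff doubleton_eq_iff)

lemma adj_cart_prod:
  assumes "sgraph G" "sgraph H"
    and "g \<in> verts G" "g' \<in> verts G" "h \<in> verts H" "h' \<in> verts H"
  shows "adj (cart_prod G H) (g, h) (g', h') \<longleftrightarrow> g = g' \<and> adj H h h' \<or> h = h' \<and> adj G g g'"
  using assms
  by (auto simp: cart_prod_def adj_def doubleton_eq_iff insert_commute)

end

theory Submission
  imports Defs
begin

text \<open>
  Lower bound: every edge of \<open>G \<box> H\<close> projects to an edge in exactly one factor, so the two
  projections of a connected subgraph containing \<open>S\<close> have together at most as many edges.

  Upper bound: let \<open>T\<^sub>G\<close>, \<open>T\<^sub>H\<close> be optimal for the two projections and let \<open>p\<^sub>1, p\<^sub>2, p\<^sub>3\<close> be the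
  three deleted points. A spanning tree of \<open>T\<^sub>G\<close> splits at the median \<open>v\<close> of the \<open>G\<close>-coordinates
  of \<open>p\<^sub>1, p\<^sub>2, p\<^sub>3\<close> into three edge-disjoint subtrees through \<open>v\<close>, the \<open>i\<close>-th one containing
  the \<open>G\<close>-coordinate of \<open>p\<^sub>i\<close>. Place the \<open>i\<close>-th subtree at the height of \<open>p\<^sub>i\<close>, which costs
  \<open>d\<^sub>G(S\<^sub>G)\<close> edges altogether. A copy of \<open>T\<^sub>H\<close> over \<open>v\<close> joins the three pieces, and one copy of
  \<open>T\<^sub>H\<close> over each of the \<open>r\<close> vertices occurring in \<open>X\<close> reaches the remaining points of \<open>S\<close>.
\<close>

section \<open>Images, unions and leaves\<close>

lemma adj_sym: "adj F u v \<Longrightarrow> adj F v u"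
  by (simp add: adj_def insert_commute)

lemma adj_rtranclp_sym: "(adj F)\<^sup>*\<^sup>* u v \<Longrightarrow> (adj F)\<^sup>*\<^sup>* v u"
  by (induction rule: rtranclp_induct) (auto intro: adj_sym converse_rtranclp_into_rtranclp)

lemma adj_rtranclp_mono:
  assumes "(adj F)\<^sup>*\<^sup>* u v" and "edges F \<subseteq> edges F'"
  shows "(adj F')\<^sup>*\<^sup>* u v"
  using assms(1) by (rule rtranclp_mono[THEN predicate2D, rotated]) (use assms(2) in \<open>auto simp: adj_def\<close>)

lemma sgraph_finite_edges: "sgraph F \<Longrightarrow> finite (edges F)"
  by (rule finite_subset[of _ "Pow (verts F)"]) (auto simp: sgraph_def)

lemma sgraph_edge_subset: "sgraph F \<Longrightarrow> e \<in> edges F \<Longrightarrow> e \<subseteq> verts F"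
  by (auto simp: sgraph_def)

lemma subgraph_sgraph: "subgraph T F \<Longrightarrow> sgraph T"
  by (simp add: subgraph_def)

lemma subgraph_refl: "sgraph F \<Longrightarrow> subgraph F F"
  by (simp add: subgraph_def)

lemma subgraph_trans: "subgraph A B \<Longrightarrow> subgraph B C \<Longrightarrow> subgraph A C"
  by (auto simp: subgraph_def)

lemma subgraph_card_edges: "subgraph T F \<Longrightarrow> sgraph F \<Longrightarrow> card (edges T) \<le> card (edges F)"
  by (auto simp: subgraph_def intro: card_mono sgraph_finite_edges)

lemma connected_graphI:
  assumes "v \<in> verts F" and "\<And>u. u \<in> verts F \<Longrightarrow> (adj F)\<^sup>*\<^sup>* v u"
  shows "connected_graph F"
  unfolding connected_graph_def
  using assms by (blast intro: rtranclp_trans adj_rtranclp_sym)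

text \<open>Edges whose ends \<open>f\<close> identifies are dropped instead of becoming loops. Thus
  one notion serves both the injective copies of a factor (rows, columns, transposition) and the
  projections of the product.\<close>

definition graph_image :: "('a \<Rightarrow> 'b) \<Rightarrow> 'a ugraph \<Rightarrow> 'b ugraph" where
  "graph_image f F = \<lparr>verts = f ` verts F, edges = {f ` e | e. e \<in> edges F \<and> card (f ` e) = 2}\<rparr>"

lemma verts_graph_image [simp]: "verts (graph_image f F) = f ` verts F"
  by (simp add: graph_image_def)

lemma edges_graph_image: "edges (graph_image f F) = (`) f ` {e \<in> edges F. card (f ` e) = 2}"
  by (auto simp: graph_image_def)

lemma sgraph_graph_image: "sgraph F \<Longrightarrow> sgraph (graph_image f F)"
  by (fastforce simp: sgraph_def edges_graph_image)

text \<open>A walk maps to a walk that pauses wherever an edge collapses.\<close>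

lemma connected_graph_image:
  assumes "connected_graph F"
  shows "connected_graph (graph_image f F)"
proof -
  have "(adj (graph_image f F))\<^sup>*\<^sup>* (f u) (f v)" if "(adj F)\<^sup>*\<^sup>* u v" for u v
    using that
  proof (induction rule: rtranclp_induct)
    case (step y z)
    show ?case
    proof (cases "f y = f z")
      case False
      then have "adj (graph_image f F) (f y) (f z)"
        using step.hyps(2) by (auto simp: adj_def edges_graph_image intro!: image_eqI[of _ _ "{y, z}"])
      then show ?thesis using step.IH by simp
    qed (use step.IH in simp)
  qed simp
  then show ?thesis
    using assms by (auto simp: connected_graph_def)
qed

text \<open>Only the edges that survive \<open>f\<close> are charged. This sharper count lets the
  two projections share one edge budget.\<close>

lemma card_edges_graph_image:
  "sgraph F \<Longrightarrow> card (edges (graph_image f F)) \<le> card {e \<in> edges F. card (f ` e) = 2}"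
  unfolding edges_graph_image by (rule card_image_le) (simp add: sgraph_finite_edges)

lemma card_edges_graph_image_le:
  assumes "sgraph F"
  shows "card (edges (graph_image f F)) \<le> card (edges F)"
proof -
  have "card {e \<in> edges F. card (f ` e) = 2} \<le> card (edges F)"
    using assms by (intro card_mono) (auto simp: sgraph_finite_edges)
  then show ?thesis using card_edges_graph_image[OF assms, of f] by simp
qed

definition graph_union :: "'a ugraph \<Rightarrow> 'a ugraph \<Rightarrow> 'a ugraph" where
  "graph_union A B = \<lparr>verts = verts A \<union> verts B, edges = edges A \<union> edges B\<rparr>"

lemma graph_union_simps [simp]:
  "verts (graph_union A B) = verts A \<union> verts B"
  "edges (graph_union A B) = edges A \<union> edges B"
  by (simp_all add: graph_union_def)

lemma subgraph_graph_union:
  "subgraph A F \<Longrightarrow> subgraph B F \<Longrightarrow> subgraph (graph_union A B) F"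
  by (auto simp: subgraph_def sgraph_def)

lemma connected_graph_union:
  assumes "connected_graph A" "connected_graph B" "verts A \<inter> verts B \<noteq> {}"
  shows "connected_graph (graph_union A B)"
proof -
  obtain v where v: "v \<in> verts A" "v \<in> verts B" using assms(3) by auto
  show ?thesis
  proof (rule connected_graphI[of v])
    fix u assume "u \<in> verts (graph_union A B)"
    then have "(adj A)\<^sup>*\<^sup>* v u \<or> (adj B)\<^sup>*\<^sup>* v u"
      using assms v by (auto simp: connected_graph_def)
    then show "(adj (graph_union A B))\<^sup>*\<^sup>* v u"
      by (auto elim: adj_rtranclp_mono)
  qed (use v in simp)
qed

definition add_leaf :: "'a \<Rightarrow> 'a \<Rightarrow> 'a ugraph \<Rightarrow> 'a ugraph" where
  "add_leaf x y F = \<lparr>verts = insert x (verts F), edges = insert {x, y} (edges F)\<rparr>"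

lemma add_leaf_simps [simp]:
  "verts (add_leaf x y F) = insert x (verts F)"
  "edges (add_leaf x y F) = insert {x, y} (edges F)"
  by (simp_all add: add_leaf_def)

lemma sgraph_add_leaf: "sgraph F \<Longrightarrow> y \<in> verts F \<Longrightarrow> x \<notin> verts F \<Longrightarrow> sgraph (add_leaf x y F)"
  by (auto simp: sgraph_def card_insert_if)

lemma connected_add_leaf:
  assumes "connected_graph F" "y \<in> verts F"
  shows "connected_graph (add_leaf x y F)"
proof (rule connected_graphI[of y])
  fix u assume "u \<in> verts (add_leaf x y F)"
  then consider "u = x" | "u \<in> verts F" by auto
  then show "(adj (add_leaf x y F))\<^sup>*\<^sup>* y u"
  proof cases
    case 1
    then show ?thesis by (auto simp: adj_def insert_commute)
  next
    case 2
    then have "(adj F)\<^sup>*\<^sup>* y u" using assms by (simp add: connected_graph_def)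
    then show ?thesis by (rule adj_rtranclp_mono) auto
  qed
qed (use assms in simp)

lemma card_edges_add_leaf:
  assumes "sgraph F" "x \<notin> verts F"
  shows "card (edges (add_leaf x y F)) = Suc (card (edges F))"
proof -
  have "{x, y} \<notin> edges F" using assms by (auto simp: sgraph_def)
  then show ?thesis using assms by (simp add: sgraph_finite_edges)
qed

section \<open>Splitting a connected graph at a median\<close>

text \<open>Trees are encoded by their construction, leaf by leaf, instead of by acyclicity. The
  induction rule is then exactly what the median argument follows.\<close>

inductive tree :: "'a ugraph \<Rightarrow> bool" where
  single: "tree \<lparr>verts = {v}, edges = {}\<rparr>"
| grow: "tree F \<Longrightarrow> x \<notin> verts F \<Longrightarrow> y \<in> verts F \<Longrightarrow> tree (add_leaf x y F)"

lemma tree_sgraph: "tree F \<Longrightarrow> sgraph F"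
  by (induction rule: tree.induct) (simp_all add: sgraph_add_leaf, simp add: sgraph_def)

lemma tree_connected: "tree F \<Longrightarrow> connected_graph F"
  by (induction rule: tree.induct) (simp_all add: connected_add_leaf, simp add: connected_graph_def)

lemma rtranclp_leaves_set:
  assumes "R\<^sup>*\<^sup>* u v" "u \<in> A" "v \<notin> A"
  obtains a b where "a \<in> A" "b \<notin> A" "R a b"
  using assms by (induction rule: rtranclp_induct) auto

text \<open>Take a tree in \<open>F\<close> with the most vertices. If it missed a vertex, a walk to
  that vertex would leave the tree along some edge, and this edge would attach one more
  leaf.\<close>

lemma spanning_tree_exists:
  assumes "sgraph F" "connected_graph F"
  obtains T where "tree T" "subgraph T F" "verts T = verts F"
proof -
  define P where "P T \<longleftrightarrow> tree T \<and> subgraph T F" for T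
  obtain v where "v \<in> verts F" using assms(2) by (auto simp: connected_graph_def)
  then have P0: "P \<lparr>verts = {v}, edges = {}\<rparr>"
    by (auto simp: P_def subgraph_def sgraph_def intro: tree.single)
  have bound: "card (verts T) < Suc (card (verts F))" if "P T" for T
    using that assms(1) by (auto simp: P_def subgraph_def sgraph_def less_Suc_eq_le intro: card_mono)
  obtain T where T: "P T" and max: "\<And>T'. P T' \<Longrightarrow> card (verts T') \<le> card (verts T)"
    using ex_has_greatest_nat[of P _ "\<lambda>T. card (verts T)"] P0 bound by blast
  have sub: "tree T" "subgraph T F" using T by (auto simp: P_def)
  have "verts T = verts F"
  proof (rule ccontr)
    assume "verts T \<noteq> verts F"
    then obtain w where w: "w \<in> verts F" "w \<notin> verts T" using sub by (auto simp: subgraph_def)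
    obtain u where u: "u \<in> verts T" using tree_connected[OF sub(1)] by (auto simp: connected_graph_def)
    have "(adj F)\<^sup>*\<^sup>* u w"
      using assms(2) u w sub by (auto simp: connected_graph_def subgraph_def)
    then obtain y x where xy: "y \<in> verts T" "x \<notin> verts T" "adj F y x"
      using u w by (auto elim: rtranclp_leaves_set)
    have "{x, y} \<in> edges F" using adj_sym[OF xy(3)] by (simp add: adj_def)
    then have "subgraph (add_leaf x y T) F"
      using sub xy sgraph_edge_subset[OF assms(1)] sgraph_add_leaf[of T y x]
      by (auto simp: subgraph_def)
    then have "P (add_leaf x y T)" using sub xy by (auto simp: P_def intro: tree.grow)
    then have "card (verts (add_leaf x y T)) \<le> card (verts T)" by (rule max)
    then show False using xy tree_sgraph[OF sub(1)] by (simp add: sgraph_def)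
  qed
  then show ?thesis using that sub by blast
qed

section \<open>Tripods and medians\<close>

text \<open>Three legs meeting in \<open>v\<close>. Edge-disjointness is recorded only through the
  sum of the edge counts, which is all that the final estimate uses. The legs cover
  \<open>verts F\<close>, so every further vertex lies on some leg.\<close>

definition tripod :: "'a ugraph \<Rightarrow> 'a \<Rightarrow> 'a ugraph \<Rightarrow> 'a ugraph \<Rightarrow> 'a ugraph \<Rightarrow> bool" where
  "tripod F v A B C \<longleftrightarrow>
     subgraph A F \<and> subgraph B F \<and> subgraph C F \<and>
     connected_graph A \<and> connected_graph B \<and> connected_graph C \<and>
     v \<in> verts A \<and> v \<in> verts B \<and> v \<in> verts C \<and>
     verts F \<subseteq> verts A \<union> verts B \<union> verts C \<and>
     card (edges A) + card (edges B) + card (edges C) \<le> card (edges F)"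

lemma tripod_rotate: "tripod F v A B C \<Longrightarrow> tripod F v B C A"
  by (auto simp: tripod_def)

text \<open>The leg containing the neighbour \<open>y\<close> receives the new leaf, and both sides
  of the edge inequality grow by one.\<close>

lemma tripod_add_leaf:
  assumes "tripod F v A B C" "sgraph F" "x \<notin> verts F" "y \<in> verts A"
  shows "tripod (add_leaf x y F) v (add_leaf x y A) B C"
proof -
  have A: "sgraph A" "x \<notin> verts A"
    using assms by (auto simp: tripod_def subgraph_def)
  then have "subgraph (add_leaf x y A) (add_leaf x y F)"
    using assms sgraph_add_leaf[of A y x] by (auto simp: tripod_def subgraph_def)
  then show ?thesis
    using assms connected_add_leaf[of A y x] card_edges_add_leaf[OF A, of y]
      card_edges_add_leaf[OF assms(2,3), of y]
    \<comment> \<open>The edge sets of the extended graphs stay folded so that the two counting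
      facts above remain applicable; the closing \<open>auto\<close> unfolds them for what is
      left.\<close>
    by (auto simp: tripod_def subgraph_def simp del: add_leaf_simps(2)) auto
qed

definition has_median :: "'a ugraph \<Rightarrow> 'a \<Rightarrow> 'a \<Rightarrow> 'a \<Rightarrow> bool" where
  "has_median F a b c \<longleftrightarrow> (\<exists>v A B C. tripod F v A B C \<and> a \<in> verts A \<and> b \<in> verts B \<and> c \<in> verts C)"

text \<open>Rotation brings any of the three terminals to any position, so the cases below need only
  one arrangement each.\<close>

lemma has_median_rotate: "has_median F a b c \<Longrightarrow> has_median F b c a"
  unfolding has_median_def by (blast intro: tripod_rotate)

text \<open>The median is \<open>a\<close> itself: two legs shrink to the single vertex
  \<open>a\<close> and the third is all of \<open>F\<close>.\<close>

lemma has_median_repeated: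
  assumes "sgraph F" "connected_graph F" "a \<in> verts F" "c \<in> verts F"
  shows "has_median F a a c"
proof -
  let ?P = "\<lparr>verts = {a}, edges = {}\<rparr>"
  have "tripod F a ?P ?P F"
    using assms by (auto simp: tripod_def subgraph_def sgraph_def connected_graph_def)
  then show ?thesis using assms(4) unfolding has_median_def by force
qed

text \<open>Every path from \<open>x\<close> starts through \<open>y\<close>, so a median for
  \<open>y\<close>, \<open>b\<close>, \<open>c\<close> still serves once the leg of \<open>y\<close>
  is prolonged to \<open>x\<close>.\<close>

lemma has_median_new_leaf:
  assumes "has_median F y b c" "sgraph F" "x \<notin> verts F"
  shows "has_median (add_leaf x y F) x b c"
proof -
  obtain v A B C where *: "tripod F v A B C" "y \<in> verts A" "b \<in> verts B" "c \<in> verts C"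
    using assms(1) by (auto simp: has_median_def)
  have "tripod (add_leaf x y F) v (add_leaf x y A) B C"
    using * assms by (intro tripod_add_leaf)
  then show ?thesis using * unfolding has_median_def by force
qed

lemma has_median_old_leaf:
  assumes "has_median F a b c" "sgraph F" "x \<notin> verts F" "y \<in> verts F"
  shows "has_median (add_leaf x y F) a b c"
proof -
  \<comment> \<open>Stated for arbitrary legs and terminals, so that it also applies to the rotated
    tripods when \<open>y\<close> lies on the second or third leg.\<close>
  have extend: "has_median (add_leaf x y F) a b c"
    if "tripod F v A B C" "a \<in> verts A" "b \<in> verts B" "c \<in> verts C" "y \<in> verts A"
    for v A B C a b c
  proof -
    have "tripod (add_leaf x y F) v (add_leaf x y A) B C"
      using that assms by (intro tripod_add_leaf)
    then show ?thesis using that unfolding has_median_def by force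
  qed
  obtain v A B C where *: "tripod F v A B C" "a \<in> verts A" "b \<in> verts B" "c \<in> verts C"
    using assms(1) by (auto simp: has_median_def)
  then have "y \<in> verts A \<or> y \<in> verts B \<or> y \<in> verts C"
    using assms(4) by (auto simp: tripod_def)
  then show ?thesis
    using * by (meson extend tripod_rotate has_median_rotate)
qed

lemma tree_has_median:
  "tree F \<Longrightarrow> a \<in> verts F \<Longrightarrow> b \<in> verts F \<Longrightarrow> c \<in> verts F \<Longrightarrow> has_median F a b c"
proof (induction arbitrary: a b c rule: tree.induct)
  case (single v)
  then show ?case
    using has_median_repeated tree.single tree_sgraph tree_connected by force
next
  case (grow F x y)
  let ?F = "add_leaf x y F"
  have F: "sgraph F" using grow.hyps tree_sgraph by blast
  have F': "sgraph ?F" "connected_graph ?F"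
    using tree.grow[OF grow.hyps] tree_sgraph tree_connected by blast+
  have leaf: "has_median ?F x p q" if "p \<in> verts F" "q \<in> verts F" for p q
    using that grow F by (intro has_median_new_leaf) auto
  consider "a = b" | "b = c" | "c = a" | "a \<noteq> b" "b \<noteq> c" "c \<noteq> a" by blast
  then show ?case
  proof cases
    case 1
    then show ?thesis using has_median_repeated[OF F', of b c] grow.prems by simp
  next
    case 2
    then show ?thesis
      using has_median_rotate[OF has_median_rotate[OF has_median_repeated[OF F', of c a]]] grow.prems by simp
  next
    case 3
    then show ?thesis
      using has_median_rotate[OF has_median_repeated[OF F', of a b]] grow.prems by simp
  next
    case 4
    \<comment> \<open>The terminals are now distinct, so at most one of them is the new leaf
      \<open>x\<close>.\<close>
    then consider "a = x" "b \<in> verts F" "c \<in> verts F" | "b = x" "c \<in> verts F" "a \<in> verts F"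
      | "c = x" "a \<in> verts F" "b \<in> verts F" | "a \<in> verts F" "b \<in> verts F" "c \<in> verts F"
      using grow.prems by auto
    then show ?thesis
    proof cases
      case 1
      then show ?thesis by (simp add: leaf)
    next
      case 2
      then show ?thesis using has_median_rotate[OF has_median_rotate[OF leaf]] by simp
    next
      case 3
      then show ?thesis using has_median_rotate[OF leaf] by simp
    next
      case 4
      then show ?thesis using grow.IH grow.hyps F by (intro has_median_old_leaf) simp_all
    qed
  qed
qed

text \<open>A tripod of a spanning tree is a tripod of \<open>F\<close>: the vertices to be covered
  are the same and the edge budget can only grow.\<close>

lemma connected_has_median:
  assumes "sgraph F" "connected_graph F" "a \<in> verts F" "b \<in> verts F" "c \<in> verts F"
  shows "has_median F a b c"
proof -
  obtain T where T: "tree T" "subgraph T F" "verts T = verts F"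
    using spanning_tree_exists[OF assms(1,2)] .
  then obtain v A B C where "tripod T v A B C" "a \<in> verts A" "b \<in> verts B" "c \<in> verts C"
    using tree_has_median[OF T(1), of a b c] assms by (auto simp: has_median_def)
  moreover from this have "tripod F v A B C"
    using T subgraph_card_edges[OF T(2) assms(1)] by (auto simp: tripod_def intro: subgraph_trans)
  ultimately show ?thesis by (auto simp: has_median_def)
qed

section \<open>Connected subgraphs of the Cartesian product\<close>

lemma verts_cart_prod [simp]: "verts (cart_prod G H) = verts G \<times> verts H"
  by (simp add: cart_prod_def)

lemma edge_cart_prod_cases:
  assumes "e \<in> edges (cart_prod G H)"
  obtains g h h' where "e = {(g, h), (g, h')}" "g \<in> verts G" "{h, h'} \<in> edges H"
  | g g' h where "e = {(g, h), (g', h)}" "h \<in> verts H" "{g, g'} \<in> edges G"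
proof -
  obtain g h g' h' where "e = {(g, h), (g', h')}" "g \<in> verts G" "h \<in> verts H"
    "g = g' \<and> {h, h'} \<in> edges H \<or> h = h' \<and> {g, g'} \<in> edges G"
    using assms by (auto simp: cart_prod_def adj_def)
  then show thesis using that by metis
qed

lemma edge_cart_prodI1:
  assumes "sgraph G" "{g, g'} \<in> edges G" "h \<in> verts H"
  shows "{(g, h), (g', h)} \<in> edges (cart_prod G H)"
  using assms sgraph_edge_subset[OF assms(1,2)] unfolding cart_prod_def adj_def by simp blast

lemma edge_cart_prodI2:
  assumes "sgraph H" "{h, h'} \<in> edges H" "g \<in> verts G"
  shows "{(g, h), (g, h')} \<in> edges (cart_prod G H)"
  using assms sgraph_edge_subset[OF assms(1,2)] unfolding cart_prod_def adj_def by simp blast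

lemma sgraph_edgeE:
  assumes "sgraph F" "e \<in> edges F"
  obtains u v where "e = {u, v}" "u \<noteq> v"
  using assms by (auto simp: sgraph_def card_2_iff)

lemma subgraph_row:
  assumes "sgraph G" "subgraph T G" "h \<in> verts H"
  shows "subgraph (graph_image (\<lambda>g. (g, h)) T) (cart_prod G H)"
proof -
  have "(\<lambda>g. (g, h)) ` e \<in> edges (cart_prod G H)" if "e \<in> edges T" for e
  proof -
    have "e \<in> edges G" using that assms(2) by (auto simp: subgraph_def)
    moreover from assms(1) this obtain u v where "e = {u, v}" by (rule sgraph_edgeE)
    ultimately show ?thesis using edge_cart_prodI1[OF assms(1) _ assms(3)] by simp
  qed
  then show ?thesis
    using assms by (auto simp: subgraph_def sgraph_graph_image edges_graph_image)
qed

lemma subgraph_column: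
  assumes "sgraph H" "subgraph T H" "g \<in> verts G"
  shows "subgraph (graph_image (\<lambda>h. (g, h)) T) (cart_prod G H)"
proof -
  have "(\<lambda>h. (g, h)) ` e \<in> edges (cart_prod G H)" if "e \<in> edges T" for e
  proof -
    have "e \<in> edges H" using that assms(2) by (auto simp: subgraph_def)
    moreover from assms(1) this obtain u v where "e = {u, v}" by (rule sgraph_edgeE)
    ultimately show ?thesis using edge_cart_prodI2[OF assms(1) _ assms(3)] by simp
  qed
  then show ?thesis
    using assms by (auto simp: subgraph_def sgraph_graph_image edges_graph_image)
qed

lemma subgraph_swap:
  assumes "sgraph G" "sgraph H" "subgraph T (cart_prod G H)"
  shows "subgraph (graph_image prod.swap T) (cart_prod H G)"
proof -
  have "prod.swap ` e \<in> edges (cart_prod H G)" if "e \<in> edges T" for e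
  proof -
    have "e \<in> edges (cart_prod G H)" using that assms(3) by (auto simp: subgraph_def)
    then show ?thesis
      by (cases rule: edge_cart_prod_cases)
        (use assms(1,2) in \<open>auto intro: edge_cart_prodI1 edge_cart_prodI2\<close>)
  qed
  then show ?thesis
    using assms by (auto simp: subgraph_def sgraph_graph_image edges_graph_image)
qed

text \<open>A product edge changes just one coordinate, so it survives in only one projection; the
  surviving edges form two disjoint subsets of \<open>edges T\<close>.\<close>

lemma subgraph_projections:
  assumes "sgraph G" "sgraph H" "subgraph T (cart_prod G H)"
  shows "subgraph (graph_image fst T) G" and "subgraph (graph_image snd T) H"
    and "card (edges (graph_image fst T)) + card (edges (graph_image snd T)) \<le> card (edges T)"
proof -
  have edgeT: "e \<in> edges (cart_prod G H)" if "e \<in> edges T" for e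
    using assms(3) that by (auto simp: subgraph_def)
  have T: "sgraph T" using assms(3) by (simp add: subgraph_def)
  \<comment> \<open>The extra conjunct in the first line is the disjointness of \<open>?E1\<close>
    and \<open>?E2\<close> below.\<close>
  have *: "(card (fst ` e) = 2 \<longrightarrow> fst ` e \<in> edges G \<and> card (snd ` e) \<noteq> 2) \<and>
           (card (snd ` e) = 2 \<longrightarrow> snd ` e \<in> edges H)" if "e \<in> edges T" for e
    using edgeT[OF that] by (cases rule: edge_cart_prod_cases) auto
  show "subgraph (graph_image fst T) G" "subgraph (graph_image snd T) H"
    using T * assms(3) by (auto simp: subgraph_def sgraph_graph_image edges_graph_image)
  let ?E1 = "{e \<in> edges T. card (fst ` e) = 2}" and ?E2 = "{e \<in> edges T. card (snd ` e) = 2}"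
  have "card ?E1 + card ?E2 = card (?E1 \<union> ?E2)"
    using T * by (intro card_Un_disjoint[symmetric]) (auto simp: sgraph_finite_edges)
  also have "\<dots> \<le> card (edges T)"
    using T by (intro card_mono) (auto simp: sgraph_finite_edges)
  finally show "card (edges (graph_image fst T)) + card (edges (graph_image snd T)) \<le> card (edges T)"
    using card_edges_graph_image[OF T, of fst] card_edges_graph_image[OF T, of snd] by linarith
qed

section \<open>Gluing pieces under an edge budget\<close>

text \<open>This is "Steiner distance at most \<open>n\<close>" with the bound in the natural
  numbers; the inequality makes budgets monotone and additive under gluing.\<close>

definition connects :: "'a ugraph \<Rightarrow> 'a set \<Rightarrow> nat \<Rightarrow> bool" where
  "connects F W n \<longleftrightarrow> (\<exists>T. subgraph T F \<and> connected_graph T \<and> W \<subseteq> verts T \<and> card (edges T) \<le> n)"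

lemma connectsI:
  "subgraph T F \<Longrightarrow> connected_graph T \<Longrightarrow> W \<subseteq> verts T \<Longrightarrow> card (edges T) \<le> n \<Longrightarrow> connects F W n"
  by (auto simp: connects_def)

lemma connects_mono: "connects F W n \<Longrightarrow> W' \<subseteq> W \<Longrightarrow> n \<le> n' \<Longrightarrow> connects F W' n'"
  by (fastforce simp: connects_def)

text \<open>A common point of \<open>W\<close> and \<open>W'\<close> lies in both witnesses, so
  their union is connected; shared edges only lower the count.\<close>

lemma connects_Un:
  assumes "connects F W n" "connects F W' n'" "W \<inter> W' \<noteq> {}"
  shows "connects F (W \<union> W') (n + n')"
proof -
  obtain A B where "subgraph A F" "connected_graph A" "W \<subseteq> verts A" "card (edges A) \<le> n"
    "subgraph B F" "connected_graph B" "W' \<subseteq> verts B" "card (edges B) \<le> n'"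
    using assms(1,2) by (auto simp: connects_def)
  moreover from this have "card (edges (graph_union A B)) \<le> n + n'"
    using card_Un_le[of "edges A" "edges B"] by simp
  ultimately show ?thesis
    using assms(3)
    by (intro connectsI[of "graph_union A B"] subgraph_graph_union connected_graph_union) auto
qed

text \<open>Each piece \<open>V x\<close> hangs directly on the core \<open>W\<close>, so the pieces
  can be attached one at a time, in any order, at cost \<open>d\<close> each.\<close>

lemma connects_UN:
  assumes "finite X" "connects F W n"
    and "\<And>x. x \<in> X \<Longrightarrow> connects F (V x) d" and "\<And>x. x \<in> X \<Longrightarrow> W \<inter> V x \<noteq> {}"
  shows "connects F (W \<union> (\<Union>x\<in>X. V x)) (n + card X * d)"
  using assms
proof (induction X rule: finite_induct)
  case (insert x X)
  have "connects F ((W \<union> (\<Union>x\<in>X. V x)) \<union> V x) (n + card X * d + d)"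
  proof (rule connects_Un)
    show "connects F (W \<union> (\<Union>x\<in>X. V x)) (n + card X * d)"
      using insert.prems by (intro insert.IH) simp_all
    show "connects F (V x) d" using insert.prems by simp
    show "(W \<union> (\<Union>x\<in>X. V x)) \<inter> V x \<noteq> {}" using insert.prems(3)[of x] by auto
  qed
  then show ?case
    using insert.hyps by (elim connects_mono) auto
qed simp

lemma connects_row:
  assumes "sgraph G" "subgraph T G" "connected_graph T" "h \<in> verts H"
  shows "connects (cart_prod G H) (verts T \<times> {h}) (card (edges T))"
  using assms
  by (intro connectsI[OF subgraph_row[of G T h H]] connected_graph_image card_edges_graph_image_le)
    (auto simp: subgraph_def)

lemma connects_column:
  assumes "sgraph H" "subgraph T H" "connected_graph T" "g \<in> verts G"
  shows "connects (cart_prod G H) ({g} \<times> verts T) (card (edges T))"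
  using assms
  by (intro connectsI[OF subgraph_column[of H T g G]] connected_graph_image card_edges_graph_image_le)
    (auto simp: subgraph_def)

lemma connects_swap:
  assumes "sgraph G" "sgraph H" "connects (cart_prod G H) W n"
  shows "connects (cart_prod H G) (prod.swap ` W) n"
proof -
  obtain T where T: "subgraph T (cart_prod G H)" "connected_graph T" "W \<subseteq> verts T" "card (edges T) \<le> n"
    using assms(3) by (auto simp: connects_def)
  have "card (edges (graph_image prod.swap T)) \<le> n"
    using card_edges_graph_image_le[OF subgraph_sgraph[OF T(1)], of prod.swap] T(4) by linarith
  then show ?thesis
    using T assms by (intro connectsI[OF subgraph_swap connected_graph_image]) auto
qed

text \<open>The three legs are paid for by \<open>edges TG\<close>. The copies of \<open>TH\<close>
  are one over each first coordinate occurring in \<open>S'\<close>, plus the one over the median,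
  which is the \<open>+ 1\<close>.\<close>

lemma connects_cart_prod:
  assumes G: "sgraph G" and H: "sgraph H"
    and TG: "subgraph TG G" "connected_graph TG" and TH: "subgraph TH H" "connected_graph TH"
    and proj: "fst ` S \<subseteq> verts TG" "snd ` S \<subseteq> verts TH"
    and S: "S = S' \<union> {p, q, s}" "finite S'"
  shows "connects (cart_prod G H) S (card (edges TG) + (card (fst ` S') + 1) * card (edges TH))"
proof -
  let ?P = "cart_prod G H" and ?d = "card (edges TH)"
  have "has_median TG (fst p) (fst q) (fst s)"
    using TG proj S by (intro connected_has_median) (auto simp: subgraph_def)
  then obtain v A B C where tri: "tripod TG v A B C"
    and in_legs: "fst p \<in> verts A" "fst q \<in> verts B" "fst s \<in> verts C"
    by (auto simp: has_median_def)
  have v: "v \<in> verts A" "v \<in> verts B" "v \<in> verts C" "v \<in> verts TG"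
    using tri by (auto simp: tripod_def subgraph_def)
  have leg: "subgraph A G" "subgraph B G" "subgraph C G"
    using tri TG by (auto simp: tripod_def intro: subgraph_trans)
  have heights: "snd p \<in> verts TH" "snd q \<in> verts TH" "snd s \<in> verts TH"
    using proj S by auto
  have subset: "verts TG \<subseteq> verts G" "verts TH \<subseteq> verts H"
    using TG TH by (auto simp: subgraph_def)
  have row: "connects ?P (verts T \<times> {h}) (card (edges T))"
    if "subgraph T G" "connected_graph T" "h \<in> verts TH" for T h
    using that G subset by (intro connects_row) auto
  have column: "connects ?P ({g} \<times> verts TH) ?d" if "g \<in> verts TG" for g
    using that H TH subset by (intro connects_column) auto
  define W where "W = {v} \<times> verts TH \<union> verts A \<times> {snd p} \<union> verts B \<times> {snd q} \<union> verts C \<times> {snd s}"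
  \<comment> \<open>The column over \<open>v\<close> comes first in \<open>W\<close>: each leg
    contains \<open>v\<close>, so its row meets this column at the height of its terminal.\<close>
  have W: "connects ?P W (?d + card (edges A) + card (edges B) + card (edges C))"
    unfolding W_def using tri leg v heights
    by (intro connects_Un row column) (auto simp: tripod_def)
  \<comment> \<open>The vertex \<open>x\<close> lies on some leg, and the column over
    \<open>x\<close> crosses that leg at the height where it was placed.\<close>
  have "W \<inter> {x} \<times> verts TH \<noteq> {}" if "x \<in> fst ` S'" for x
  proof -
    have "x \<in> verts A \<union> verts B \<union> verts C"
      using that proj S tri by (auto simp: tripod_def)
    then show ?thesis using heights by (auto simp: W_def)
  qed
  then have "connects ?P (W \<union> (\<Union>x\<in>fst ` S'. {x} \<times> verts TH))
      (?d + card (edges A) + card (edges B) + card (edges C) + card (fst ` S') * ?d)"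
    using proj S by (intro connects_UN W column) auto
  then show ?thesis
  proof (rule connects_mono)
    show "S \<subseteq> W \<union> (\<Union>x\<in>fst ` S'. {x} \<times> verts TH)"
    proof
      fix z assume z: "z \<in> S"
      then consider "z \<in> S'" | "z = p" | "z = q" | "z = s" using S by auto
      then show "z \<in> W \<union> (\<Union>x\<in>fst ` S'. {x} \<times> verts TH)"
      proof cases
        case 1
        then have "z \<in> {fst z} \<times> verts TH" using z proj by (cases z) auto
        then show ?thesis using 1 by (intro UnI2 UN_I[of "fst z"]) simp_all
      qed (use in_legs in \<open>auto simp: W_def mem_Times_iff\<close>)
    qed
    show "?d + card (edges A) + card (edges B) + card (edges C) + card (fst ` S') * ?d
        \<le> card (edges TG) + (card (fst ` S') + 1) * ?d"
      using tri by (simp add: tripod_def)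
  qed
qed

section \<open>Steiner distance\<close>

lemma steiner_dist_le: "connects F W n \<Longrightarrow> steiner_dist F W \<le> enat n"
  unfolding connects_def steiner_dist_def
  by (elim exE conjE, rule Inf_lower2) (auto intro: exI)

lemma steiner_dist_attained:
  assumes "sgraph F" "connected_graph F" "W \<subseteq> verts F"
  obtains T where "subgraph T F" "connected_graph T" "W \<subseteq> verts T"
    "steiner_dist F W = enat (card (edges T))"
proof -
  let ?D = "{enat (card (edges T)) | T. subgraph T F \<and> connected_graph T \<and> W \<subseteq> verts T}"
  \<comment> \<open>\<open>F\<close> itself is a competitor, so the infimum is over a nonempty set
    and is attained.\<close>
  have "enat (card (edges F)) \<in> ?D" using assms subgraph_refl by blast
  then have "Inf ?D \<in> ?D" by (auto simp: Inf_enat_def intro: LeastI)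
  then show ?thesis using that unfolding steiner_dist_def by blast
qed

text \<open>Translates between entries of a projected multiset and points of \<open>S\<close>: an
  optimal sub-multiset is the projection of an actual subset, whose complement supplies the deleted
  points.\<close>

lemma min_distinct_image_attained:
  fixes f :: "'a \<Rightarrow> 'b"
  assumes "finite S" "q \<le> card S"
  obtains S' where "S' \<subseteq> S" "card S' = q"
    "min_distinct q (image_mset f (mset_set S)) = card (f ` S')"
proof -
  let ?M = "image_mset f (mset_set S)"
  let ?D = "{card (set_mset X) | X. X \<subseteq># ?M \<and> size X = q}"
  obtain S0 where "S0 \<subseteq> S" "card S0 = q" using assms(2) by (metis obtain_subset_with_card_n)
  then have "image_mset f (mset_set S0) \<subseteq># ?M" "size (image_mset f (mset_set S0)) = q"
    using assms(1) by (auto intro!: image_mset_subseteq_mono subset_imp_msubset_mset_set)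
  then have "?D \<noteq> {}" by blast
  moreover have "card (set_mset X) \<le> size X" for X :: "'b multiset"
    using size_mset_mono[OF mset_set_set_mset_msubset, of X] by simp
  \<comment> \<open>Without nonemptiness and finiteness \<open>Min\<close> would say nothing about
    its argument.\<close>
  then have "?D \<subseteq> {..q}" by auto
  then have "finite ?D" by (rule finite_subset) simp
  ultimately have "Min ?D \<in> ?D" by (rule Min_in[rotated])
  then obtain X where X: "X \<subseteq># ?M" "size X = q" "min_distinct q ?M = card (set_mset X)"
    by (auto simp: min_distinct_def)
  then obtain Y where "?M = X + Y" by (auto simp: subset_mset.le_iff_add)
  \<comment> \<open>A splitting of an image multiset lifts to a splitting of its source.\<close>
  then obtain X' where X': "X' \<subseteq># mset_set S" "X = image_mset f X'"
    by (metis image_mset_eq_plusD mset_subset_eq_add_left)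
  \<comment> \<open>Points of \<open>S\<close> have multiplicity one, so \<open>X'\<close> is a set
    in disguise, of size \<open>q\<close>.\<close>
  have "count X' x \<le> 1" for x
    using mset_subset_eq_count[OF X'(1), of x] by (simp add: count_mset_set' split: if_splits)
  then have "count X' x = count (mset_set (set_mset X')) x" for x
    by (cases "x \<in># X'") (simp_all add: count_mset_set' not_in_iff le_antisym Suc_le_eq)
  then have "X' = mset_set (set_mset X')" by (rule multiset_eqI)
  then have "card (set_mset X') = size X'" by (metis size_mset_set)
  moreover have "set_mset X' \<subseteq> S"
    using set_mset_mono[OF X'(1)] assms(1) by simp
  ultimately show ?thesis using that[of "set_mset X'"] X X' by simp
qed

section \<open>Lower and upper bounds for the Steiner distance\<close>

lemma steiner_dist_cart_prod_ge:
  assumes "sgraph G" "sgraph H"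
  shows "steiner_dist G (fst ` S) + steiner_dist H (snd ` S) \<le> steiner_dist (cart_prod G H) S"
proof -
  have "steiner_dist G (fst ` S) + steiner_dist H (snd ` S) \<le> enat (card (edges T))"
    if T: "subgraph T (cart_prod G H)" "connected_graph T" "S \<subseteq> verts T" for T
  proof -
    note proj = subgraph_projections[OF assms T(1)]
    have "steiner_dist G (fst ` S) \<le> enat (card (edges (graph_image fst T)))"
      using T by (intro steiner_dist_le connectsI[OF proj(1) connected_graph_image]) auto
    moreover have "steiner_dist H (snd ` S) \<le> enat (card (edges (graph_image snd T)))"
      using T by (intro steiner_dist_le connectsI[OF proj(2) connected_graph_image]) auto
    ultimately have "steiner_dist G (fst ` S) + steiner_dist H (snd ` S)
        \<le> enat (card (edges (graph_image fst T)) + card (edges (graph_image snd T)))"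
      unfolding plus_enat_simps(1)[symmetric] by (rule add_mono)
    also have "\<dots> \<le> enat (card (edges T))" using proj(3) by simp
    finally show ?thesis .
  qed
  then show ?thesis
    unfolding steiner_dist_def[of "cart_prod G H"] by (auto intro!: Inf_greatest)
qed

lemma steiner_dist_cart_prod_le:
  assumes "sgraph G" "connected_graph G" "sgraph H" "connected_graph H"
    and S: "S \<subseteq> verts (cart_prod G H)" "3 \<le> card S"
  shows "steiner_dist (cart_prod G H) S \<le> steiner_dist G (fst ` S) +
    enat (min_distinct (card S - 3) (image_mset fst (mset_set S)) + 1) * steiner_dist H (snd ` S)"
proof -
  have fin: "finite S" using S(2) by (metis card.infinite not_numeral_le_zero)
  have "fst ` S \<subseteq> verts G" "snd ` S \<subseteq> verts H" using S by auto
  then obtain TG TH where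
    TG: "subgraph TG G" "connected_graph TG" "fst ` S \<subseteq> verts TG"
      "steiner_dist G (fst ` S) = enat (card (edges TG))" and
    TH: "subgraph TH H" "connected_graph TH" "snd ` S \<subseteq> verts TH"
      "steiner_dist H (snd ` S) = enat (card (edges TH))"
    using assms(1-4) by (meson steiner_dist_attained)
  obtain S' where S': "S' \<subseteq> S" "card S' = card S - 3"
    "min_distinct (card S - 3) (image_mset fst (mset_set S)) = card (fst ` S')"
    using min_distinct_image_attained[OF fin, of "card S - 3" fst] by auto
  \<comment> \<open>The truncated subtraction \<open>card S - 3\<close> is exact because
    \<open>3 \<le> card S\<close>; the complement therefore consists of exactly three
    points.\<close>
  have "card (S - S') = 3"
    using S S' fin by (simp add: card_Diff_subset finite_subset)
  then obtain p q s where "S - S' = {p, q, s}" by (auto simp: card_3_iff)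
  then have "S = S' \<union> {p, q, s}" using S' by auto
  then have "connects (cart_prod G H) S (card (edges TG) + (card (fst ` S') + 1) * card (edges TH))"
    using connects_cart_prod[OF assms(1,3) TG(1,2) TH(1,2) TG(3) TH(3)] finite_subset[OF S'(1) fin]
    by blast
  then have "steiner_dist (cart_prod G H) S
      \<le> enat (card (edges TG) + (card (fst ` S') + 1) * card (edges TH))"
    by (rule steiner_dist_le)
  then show ?thesis by (simp only: TG(4) TH(4) S'(3) plus_enat_simps times_enat_simps)
qed

text \<open>Transposing a competitor for the swapped set gives one for \<open>S\<close> with no more
  edges, since transposition is its own inverse.\<close>

lemma steiner_dist_cart_prod_swap_le:
  assumes "sgraph G" "sgraph H"
  shows "steiner_dist (cart_prod G H) S \<le> steiner_dist (cart_prod H G) (prod.swap ` S)"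
proof -
  have "steiner_dist (cart_prod G H) S \<le> enat (card (edges T))"
    if "subgraph T (cart_prod H G)" "connected_graph T" "prod.swap ` S \<subseteq> verts T" for T
    using connects_swap[OF assms(2,1) connectsI[OF that order_refl]]
    by (intro steiner_dist_le) (simp add: image_image)
  then show ?thesis
    unfolding steiner_dist_def[of "cart_prod H G"] by (auto intro!: Inf_greatest)
qed

theorem theorem2p1:
  fixes k m n r t :: nat
    and G :: "'a ugraph" and H :: "'b ugraph"
    and S :: "('a \<times> 'b) set"
    and S_G :: "'a multiset" and S_H :: "'b multiset"
  assumes "3 \<le> k" and "k \<le> m * n"
    and "sgraph G" and "connected_graph G" and "card (verts G) = n"
    and "sgraph H" and "connected_graph H" and "card (verts H) = m"
    and "S \<subseteq> verts (cart_prod G H)" and "card S = k"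
    and "S_G = image_mset fst (mset_set S)"
    and "S_H = image_mset snd (mset_set S)"
    and "r = min_distinct (k - 3) S_G"
    and "t = min_distinct (k - 3) S_H"
  shows "steiner_dist G (set_mset S_G) + steiner_dist H (set_mset S_H)
           \<le> steiner_dist (cart_prod G H) S
       \<and> steiner_dist (cart_prod G H) S
           \<le> min (steiner_dist G (set_mset S_G) + enat (r + 1) * steiner_dist H (set_mset S_H))
                 (steiner_dist H (set_mset S_H) + enat (t + 1) * steiner_dist G (set_mset S_G))"
proof -
  have fin: "finite S" using assms(1,10) by (metis card.infinite not_numeral_le_zero)
  have proj: "set_mset S_G = fst ` S" "set_mset S_H = snd ` S"
    using fin assms(11,12) by simp_all
  \<comment> \<open>The bound with \<open>t\<close> is the bound with \<open>r\<close> for the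
    factors in reverse order, applied to the transposed set: its multiset of first coordinates is
    \<open>S_H\<close>.\<close>
  let ?S' = "prod.swap ` S"
  have "mset_set ?S' = image_mset prod.swap (mset_set S)"
    by (simp add: image_mset_mset_set)
  then have swap: "image_mset fst (mset_set ?S') = S_H" "fst ` ?S' = snd ` S" "snd ` ?S' = fst ` S"
      "card ?S' = card S"
    using assms(12) by (simp_all add: multiset.map_comp image_image card_image comp_def)
  have "steiner_dist (cart_prod G H) S \<le> steiner_dist (cart_prod H G) ?S'"
    by (rule steiner_dist_cart_prod_swap_le) fact+
  also have "\<dots> \<le> steiner_dist H (fst ` ?S') +
      enat (min_distinct (card ?S' - 3) (image_mset fst (mset_set ?S')) + 1) * steiner_dist G (snd ` ?S')"
    using assms by (intro steiner_dist_cart_prod_le) (auto simp: swap)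
  finally have "steiner_dist (cart_prod G H) S
      \<le> steiner_dist H (snd ` S) + enat (t + 1) * steiner_dist G (fst ` S)"
    using assms(10,14) by (simp add: swap)
  moreover have "steiner_dist (cart_prod G H) S
      \<le> steiner_dist G (fst ` S) + enat (r + 1) * steiner_dist H (snd ` S)"
    using steiner_dist_cart_prod_le[OF assms(3,4,6,7,9)] assms by simp
  ultimately show ?thesis
    using steiner_dist_cart_prod_ge[OF assms(3,6)] by (simp add: proj)
qed

end
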